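(* Let $n$ be an integer and $a=2-n$. Let $X$ be the toric $\mathbb{CP}^1$-bundle over the Hirzebruch surface $\mathbb F_n$ with charges $$q^1:=(1,1,n,0,0,a),\qquad q^2:=(0,0,1,1,0,-2),\qquad q^3:=(0,0,0,0,1,1).$$ Consider the standard holomorphic volume form $\Omega_0=dz_1\wedge\cdots\wedge dz_6$ on $\mathbb C^6$, which is of charge $q$ with respect to this action of $T^3$. Then the form $$\alpha=z_5(-z_2dz_1+z_1dz_2)+z_6\Big(-z_4dz_3+z_3dz_4+\frac{nz_3z_4}{|z_1|^2+|z_2|^2}(\overline{z_1}dz_1+\overline{z_2}dz_2)\Big)$$ is a twist form of charge $\frac q2$.
   Context: $X$ is described as a toric quotient of $(\mathbb C^2\setminus\{0\})\times(\mathbb C^2\setminus\{0\})\times(\mathbb C^2\setminus\{0\})\subset\mathbb C^6$, with coordinates $(z_1,z_2),(z_3,z_4),(z_5,z_6)$ on the three factors, by the action of $T^3$ in which the $k$-th circle factor acts by $e^{it}\cdot z_j=e^{iq^k_jt}z_j$ (where $q^k_j$ is the $j$-th entry of $q^k$). The form $\alpha$ is considered on this space $(\mathbb C^2\setminus\{0\})^3$. Let $\mathfrak t=\mathrm{Lie}(T^3)$ and for $v\in\mathfrak t$ let $V_v(p)=\frac{d}{dt}|_{t=0}\exp(tv)\cdot p$. A form $\Phi$ has charge $k:\mathfrak t\to\mathbb C$ (linear) if $\mathcal L_{V_v}\Phi=k(v)\Phi$ for all $v\in\mathfrak t$; $q$ is the charge of $\Omega_0$. A twist form is a $1$-form $\alpha$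 that is (1) a nowhere-vanishing $(1,0)$-form; (2) horizontal: $\alpha(V_v)=0$ for all $v\in\mathfrak t$; (3) charge definite: there exists a linear form $k_\alpha:\mathfrak t\to\mathbb C$, called the charge of $\alpha$, such that $\mathcal L_{V_v}\alpha=k_\alpha(v)\alpha$ for all $v\in\mathfrak t$. *)

theory Defs
  imports "HOL-Analysis.Analysis"
begin

text \<open>A complex-valued form on \<open>\<complex>\<^sup>d\<close>, of degree the cardinality of \<open>'k\<close>, takes a point and a
  \<open>'k\<close>-tuple of (real) tangent vectors. Multilinearity is over the reals.\<close>

type_synonym ('d, 'k) form = "complex ^ 'd \<Rightarrow> (complex ^ 'd) ^ 'k \<Rightarrow> complex"

text \<open>Used only for open \<open>U\<close>; derivatives are real.\<close>

primrec Ck_on :: "nat \<Rightarrow> 'a::real_normed_vector set \<Rightarrow> ('a \<Rightarrow> 'b::real_normed_vector) \<Rightarrow> bool" where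
  "Ck_on 0 U f \<longleftrightarrow> continuous_on U f"
| "Ck_on (Suc m) U f \<longleftrightarrow>
     (\<forall>x\<in>U. f differentiable (at x)) \<and> (\<forall>w. Ck_on m U (\<lambda>x. frechet_derivative f (at x) w))"

definition smooth_on :: "'a::real_normed_vector set \<Rightarrow> ('a \<Rightarrow> 'b::real_normed_vector) \<Rightarrow> bool" where
  "smooth_on U f \<longleftrightarrow> (\<forall>m. Ck_on m U f)"

definition differential_form :: "(complex ^ 'd) set \<Rightarrow> ('d::finite, 'k::finite) form \<Rightarrow> bool" where
  "differential_form U \<Phi> \<longleftrightarrow>
     (\<forall>p\<in>U. \<forall>W i. linear (\<lambda>w. \<Phi> p (\<chi> j. if j = i then w else W $ j))) \<and>
     (\<forall>p\<in>U. \<forall>W i j. i \<noteq> j \<longrightarrow> W $ i = W $ j \<longrightarrow> \<Phi> p W = 0) \<and>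
     (\<forall>W. smooth_on U (\<lambda>p. \<Phi> p W))"

definition dz :: "'d \<Rightarrow> ('d::finite, 1) form" where
  "dz j p W = W $ 1 $ j"

definition wedge :: "('k \<Rightarrow> ('d::finite, 1) form) \<Rightarrow> ('d, 'k::finite) form" where
  "wedge A p W = det (\<chi> i j. A j p (vec (W $ i)))"

definition pullback :: "(complex ^ 'd \<Rightarrow> complex ^ 'd) \<Rightarrow> ('d::finite, 'k::finite) form \<Rightarrow> ('d, 'k) form" where
  "pullback f \<Phi> p W = \<Phi> (f p) (\<chi> i. frechet_derivative f (at p) (W $ i))"

definition local_flow ::
  "'a::real_normed_vector set \<Rightarrow> ('a \<Rightarrow> 'a) \<Rightarrow> 'a \<Rightarrow> (real \<Rightarrow> 'a \<Rightarrow> 'a) \<Rightarrow> bool" where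
  "local_flow U V p \<phi> \<longleftrightarrow>
     (\<exists>\<epsilon>>0. \<exists>N. open N \<and> p \<in> N \<and> N \<subseteq> U \<and>
        (\<forall>x\<in>N. \<phi> 0 x = x \<and>
           (\<forall>t. \<bar>t\<bar> < \<epsilon> \<longrightarrow>
              \<phi> t x \<in> U \<and> \<phi> t differentiable (at x) \<and>
              ((\<lambda>s. \<phi> s x) has_vector_derivative V (\<phi> t x)) (at t))))"

text \<open>\<open>\<L>\<^sub>V \<Phi> = \<Psi>\<close> on \<open>U\<close>, where the Lie derivative is the derivative at time 0 of the pullback
  along the flow of \<open>V\<close>. For smooth \<open>V\<close> the local flow exists and is unique, so the
  choice of \<open>\<phi>\<close> is immaterial.\<close>

definition has_Lie_derivative ::
  "(complex ^ 'd) set \<Rightarrow> (complex ^ 'd \<Rightarrow> complex ^ 'd) \<Rightarrow>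
     ('d::finite, 'k::finite) form \<Rightarrow> ('d, 'k) form \<Rightarrow> bool" where
  "has_Lie_derivative U V \<Phi> \<Psi> \<longleftrightarrow>
     (\<forall>p\<in>U. \<exists>\<phi>. local_flow U V p \<phi> \<and>
        (\<forall>W. ((\<lambda>t. pullback (\<phi> t) \<Phi> p W) has_vector_derivative \<Psi> p W) (at 0)))"

text \<open>The torus \<open>T\<^sup>r\<close> sits in \<open>\<complex>\<^sup>r\<close> as the tuples of unit complex numbers and has Lie algebra
  \<open>\<real>\<^sup>r\<close>. The row \<open>Q $ k\<close> of the charge matrix lists the weights of the \<open>k\<close>-th circle factor.\<close>

definition torus_exp :: "real ^ 'r \<Rightarrow> complex ^ 'r" where
  "torus_exp v = (\<chi> k. cis (v $ k))"

definition torus_act :: "int ^ 'd ^ 'r \<Rightarrow> complex ^ 'r \<Rightarrow> complex ^ 'd \<Rightarrow> complex ^ 'd" where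
  "torus_act Q l z = (\<chi> j. (\<Prod>k\<in>UNIV. (l $ k) powi (Q $ k $ j)) * z $ j)"

definition fundamental_field ::
  "int ^ 'd ^ 'r \<Rightarrow> real ^ 'r \<Rightarrow> complex ^ 'd \<Rightarrow> complex ^ 'd::finite" where
  "fundamental_field Q v p =
     vector_derivative (\<lambda>t. torus_act Q (torus_exp (t *\<^sub>R v)) p) (at 0)"

definition has_charge ::
  "(complex ^ 'd) set \<Rightarrow> int ^ 'd ^ 'r \<Rightarrow> ('d::finite, 'k::finite) form \<Rightarrow>
     (real ^ 'r \<Rightarrow> complex) \<Rightarrow> bool" where
  "has_charge U Q \<Phi> c \<longleftrightarrow>
     differential_form U \<Phi> \<and> linear c \<and>
     (\<forall>v. has_Lie_derivative U (fundamental_field Q v) \<Phi> (\<lambda>p W. c v * \<Phi> p W))"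

definition nowhere_vanishing :: "(complex ^ 'd) set \<Rightarrow> ('d::finite, 'k::finite) form \<Rightarrow> bool" where
  "nowhere_vanishing U \<Phi> \<longleftrightarrow> (\<forall>p\<in>U. \<exists>W. \<Phi> p W \<noteq> 0)"

text \<open>A 1-form has type (1,0) iff it intertwines the complex structure with
  multiplication by \<open>\<i>\<close>.\<close>

definition type_1_0 :: "(complex ^ 'd) set \<Rightarrow> ('d::finite, 1) form \<Rightarrow> bool" where
  "type_1_0 U \<alpha> \<longleftrightarrow> (\<forall>p\<in>U. \<forall>w. \<alpha> p (vec (\<i> *s w)) = \<i> * \<alpha> p (vec w))"

definition horizontal :: "(complex ^ 'd) set \<Rightarrow> int ^ 'd ^ 'r \<Rightarrow> ('d::finite, 1) form \<Rightarrow> bool" where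
  "horizontal U Q \<alpha> \<longleftrightarrow> (\<forall>v. \<forall>p\<in>U. \<alpha> p (vec (fundamental_field Q v p)) = 0)"

definition twist_form :: "(complex ^ 'd) set \<Rightarrow> int ^ 'd ^ 'r \<Rightarrow> ('d::finite, 1) form \<Rightarrow> bool" where
  "twist_form U Q \<alpha> \<longleftrightarrow>
     differential_form U \<alpha> \<and> nowhere_vanishing U \<alpha> \<and> type_1_0 U \<alpha> \<and>
     horizontal U Q \<alpha> \<and> (\<exists>c. has_charge U Q \<alpha> c)"

text \<open>In the index type \<open>6\<close> the numeral 6 equals 0; the indices 1 to 6 are still distinct.\<close>

definition hirzebruch_bundle_space :: "(complex ^ 6) set" where
  "hirzebruch_bundle_space =
     {z. (z $ 1, z $ 2) \<noteq> (0, 0) \<and> (z $ 3, z $ 4) \<noteq> (0, 0) \<and> (z $ 5, z $ 6) \<noteq> (0, 0)}"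

definition hirzebruch_bundle_charges :: "int \<Rightarrow> int \<Rightarrow> int ^ 6 ^ 3" where
  "hirzebruch_bundle_charges n a =
     vector [vector [1, 1, n, 0, 0, a],
             vector [0, 0, 1, 1, 0, - 2],
             vector [0, 0, 0, 0, 1, 1]]"

definition \<Omega>\<^sub>0 :: "(6, 6) form" where
  "\<Omega>\<^sub>0 = wedge dz"

definition hirzebruch_bundle_form :: "int \<Rightarrow> (6, 1) form" where
  "hirzebruch_bundle_form n z W =
     z $ 5 * (- (z $ 2) * dz 1 z W + z $ 1 * dz 2 z W)
     + z $ 6 * (- (z $ 4) * dz 3 z W + z $ 3 * dz 4 z W
         + of_int n * z $ 3 * z $ 4 / of_real ((cmod (z $ 1))\<^sup>2 + (cmod (z $ 2))\<^sup>2)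
           * (cnj (z $ 1) * dz 1 z W + cnj (z $ 2) * dz 2 z W))"

end

theory Submission
  imports Defs
begin

text \<open>The element \<open>exp v\<close> of the torus multiplies \<open>z\<^sub>j\<close> by the phase \<open>exp (\<i> w\<^sub>j)\<close>, where the weight
  \<open>w\<^sub>j\<close> is linear in \<open>v\<close>. The flow of a fundamental field is therefore explicit and linear, and
  a form has charge \<open>\<i> \<theta>\<close> as soon as \<open>exp v\<close> multiplies it by \<open>exp (\<i> \<theta>(v))\<close>
  (\<open>has_charge_if_equivariant\<close>); no Lie derivative has to be computed. For the volume form \<open>\<theta>\<close> is
  the sum of all weights, which is \<open>(2 + n + a) v\<^sub>1 + 2 v\<^sub>3 = 2 (2 v\<^sub>1 + v\<^sub>3)\<close>.

  Put \<open>\<beta> = \<partial> log (|z\<^sub>1|\<^sup>2 + |z\<^sub>2|\<^sup>2)\<close>. Then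
  \<open>\<alpha> = z\<^sub>5 (z\<^sub>1 dz\<^sub>2 - z\<^sub>2 dz\<^sub>1) + z\<^sub>6 (z\<^sub>3 dz\<^sub>4 - z\<^sub>4 dz\<^sub>3 + n z\<^sub>3 z\<^sub>4 \<beta>)\<close>. The form \<open>\<beta>\<close> is invariant
  since \<open>z\<^sub>1\<close> and \<open>z\<^sub>2\<close> have the same weight, and it takes the value \<open>\<i> v\<^sub>1\<close> on the fundamental field
  of \<open>v\<close>. Hence every term of \<open>\<alpha>\<close> has the weight \<open>w\<^sub>5 + w\<^sub>1 + w\<^sub>2 = w\<^sub>6 + w\<^sub>3 + w\<^sub>4 = 2 v\<^sub>1 + v\<^sub>3\<close>, half
  that of the volume form (\<open>has_charge_hirzebruch\<close>), and the term with \<open>\<beta>\<close> makes up for the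
  difference of the weights of \<open>z\<^sub>3\<close> and \<open>z\<^sub>4\<close>, which makes \<open>\<alpha>\<close> horizontal
  (\<open>horizontal_hirzebruch\<close>). That \<open>\<alpha>\<close> has no zeros uses that none of the three pairs of
  coordinates vanishes (\<open>nowhere_vanishing_hirzebruch\<close>). Smoothness follows from the closure of
  smooth functions under sums, products and quotients.\<close>

section \<open>Calculus of smooth functions\<close>

lemma Ck_on_Suc_imp: "Ck_on (Suc m) U f \<Longrightarrow> Ck_on m U f"
proof (induction m arbitrary: f)
  case 0
  then show ?case
    by (auto intro!: differentiable_imp_continuous_on
        simp: differentiable_on_def differentiable_at_withinI)
next
  case (Suc m)
  then have "Ck_on (Suc m) U (\<lambda>x. frechet_derivative f (at x) w)" for w
    by (simp only: Ck_on.simps(2)[of "Suc m"])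
  with Suc.IH have "Ck_on m U (\<lambda>x. frechet_derivative f (at x) w)" for w .
  with Suc.prems show ?case by simp
qed

lemma Ck_on_cong:
  assumes "open U" and "\<And>x. x \<in> U \<Longrightarrow> f x = g x" and "Ck_on m U f"
  shows "Ck_on m U g"
  using assms(2,3)
proof (induction m arbitrary: f g)
  case 0
  then show ?case by (metis Ck_on.simps(1) continuous_on_cong)
next
  case (Suc m)
  have d: "(g has_derivative frechet_derivative f (at x)) (at x)" if "x \<in> U" for x
  proof (rule has_derivative_transform_within_open[OF _ assms(1) that Suc.prems(1)])
    show "(f has_derivative frechet_derivative f (at x)) (at x)"
      using Suc.prems(2) that unfolding frechet_derivative_works[symmetric] by simp
  qed
  have eq: "frechet_derivative f (at x) w = frechet_derivative g (at x) w" if "x \<in> U" for x w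
    using frechet_derivative_at[OF d[OF that]] by simp
  have "Ck_on m U (\<lambda>x. frechet_derivative g (at x) w)" for w
    using Suc.prems(2) by (intro Suc.IH[OF eq]) simp_all
  then show ?case using differentiableI[OF d] by simp
qed

text \<open>The definition refers to \<open>frechet_derivative\<close>, a choice that is arbitrary where \<open>f\<close> is not
  differentiable. On the open set it agrees with any known derivative, and agreement there
  is enough by \<open>Ck_on_cong\<close>.\<close>

lemma Ck_on_SucI:
  assumes "open U"
    and "\<And>x. x \<in> U \<Longrightarrow> (f has_derivative D x) (at x)"
    and "\<And>w. Ck_on m U (\<lambda>x. D x w)"
  shows "Ck_on (Suc m) U f"
proof -
  have "Ck_on m U (\<lambda>x. frechet_derivative f (at x) w)" for w
    using frechet_derivative_at[OF assms(2)]
    by (intro Ck_on_cong[OF assms(1) _ assms(3)[of w]]) simp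
  then show ?thesis using differentiableI[OF assms(2)] by simp
qed

lemma Ck_on_SucD:
  assumes "Ck_on (Suc m) U f"
  shows "x \<in> U \<Longrightarrow> (f has_derivative frechet_derivative f (at x)) (at x)"
    and "Ck_on m U (\<lambda>x. frechet_derivative f (at x) w)"
  using assms by (simp_all flip: frechet_derivative_works)

lemma smooth_on_const: "smooth_on U (\<lambda>x. c)"
proof -
  have "Ck_on m U (\<lambda>x. c)" for m by (induction m arbitrary: c) auto
  then show ?thesis by (simp add: smooth_on_def)
qed

lemma smooth_on_bounded_linear:
  assumes "open U" and "bounded_linear f"
  shows "smooth_on U f"
proof -
  have "Ck_on m U f" for m
  proof (cases m)
    case 0
    then show ?thesis using assms(2) by (simp add: linear_continuous_on)
  next
    case (Suc k)
    have "Ck_on k U (\<lambda>x. f w)" for w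
      using smooth_on_const[of U "f w"] by (simp add: smooth_on_def)
    with Ck_on_SucI[OF assms(1) bounded_linear.has_derivative[OF assms(2) has_derivative_ident]]
    show ?thesis unfolding Suc .
  qed
  then show ?thesis by (simp add: smooth_on_def)
qed

lemma Ck_on_add:
  assumes "open U" "Ck_on m U f" "Ck_on m U g"
  shows "Ck_on m U (\<lambda>x. f x + g x)"
  using assms(2,3)
proof (induction m arbitrary: f g)
  case 0
  then show ?case by (simp add: continuous_on_add)
next
  case (Suc m)
  note f = Ck_on_SucD[OF Suc.prems(1)] and g = Ck_on_SucD[OF Suc.prems(2)]
  show ?case
    by (rule Ck_on_SucI[OF assms(1) has_derivative_add[OF f(1) g(1)] Suc.IH[OF f(2) g(2)]])
qed

lemma Ck_on_mult:
  fixes f g :: "'a::real_normed_vector \<Rightarrow> 'b::real_normed_algebra"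
  assumes "open U" "Ck_on m U f" "Ck_on m U g"
  shows "Ck_on m U (\<lambda>x. f x * g x)"
  using assms(2,3)
proof (induction m arbitrary: f g)
  case 0
  then show ?case by (simp add: continuous_on_mult)
next
  case (Suc m)
  note f = Ck_on_SucD[OF Suc.prems(1)] and g = Ck_on_SucD[OF Suc.prems(2)]
  note f' = Ck_on_Suc_imp[OF Suc.prems(1)] and g' = Ck_on_Suc_imp[OF Suc.prems(2)]
  show ?case
    by (rule Ck_on_SucI[OF assms(1) has_derivative_mult[OF f(1) g(1)]
          Ck_on_add[OF assms(1) Suc.IH[OF f' g(2)] Suc.IH[OF f(2) g']]])
qed

lemma Ck_on_inverse:
  fixes f :: "'a::real_normed_vector \<Rightarrow> 'b::real_normed_field"
  assumes "open U" "\<And>x. x \<in> U \<Longrightarrow> f x \<noteq> 0" "Ck_on m U f"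
  shows "Ck_on m U (\<lambda>x. inverse (f x))"
  using assms(3)
proof (induction m)
  case 0
  then show ?case using assms(2) by (simp add: continuous_on_inverse)
next
  case (Suc m)
  note f = Ck_on_SucD[OF Suc.prems] and i = Suc.IH[OF Ck_on_Suc_imp[OF Suc.prems]]
  have c: "Ck_on m U (\<lambda>x. - 1 :: 'b)" using smooth_on_const[of U "- 1 :: 'b"] by (simp add: smooth_on_def)
  show ?case
  proof (rule Ck_on_SucI[OF assms(1)])
    show "((\<lambda>x. inverse (f x)) has_derivative
        (\<lambda>h. - 1 * (inverse (f x) * frechet_derivative f (at x) h * inverse (f x)))) (at x)"
      if "x \<in> U" for x
      using Deriv.has_derivative_inverse[OF assms(2)[OF that] f(1)[OF that]] by simp
  qed (intro Ck_on_mult assms(1) c i f(2))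
qed

lemma smooth_on_add:
  "\<lbrakk>open U; smooth_on U f; smooth_on U g\<rbrakk> \<Longrightarrow> smooth_on U (\<lambda>x. f x + g x)"
  by (simp add: smooth_on_def Ck_on_add)

lemma smooth_on_mult:
  fixes f g :: "'a::real_normed_vector \<Rightarrow> 'b::real_normed_algebra"
  shows "\<lbrakk>open U; smooth_on U f; smooth_on U g\<rbrakk> \<Longrightarrow> smooth_on U (\<lambda>x. f x * g x)"
  by (simp add: smooth_on_def Ck_on_mult)

lemma smooth_on_uminus:
  assumes "open U" "smooth_on U f"
  shows "smooth_on U (\<lambda>x. - f x :: 'b::real_normed_algebra_1)"
  using smooth_on_mult[OF assms(1) smooth_on_const[where c = "- 1"] assms(2)] by simp

lemma smooth_on_divide:
  fixes f g :: "'a::real_normed_vector \<Rightarrow> 'b::real_normed_field"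
  assumes "open U" "smooth_on U f" "smooth_on U g" "\<And>x. x \<in> U \<Longrightarrow> g x \<noteq> 0"
  shows "smooth_on U (\<lambda>x. f x / g x)"
  using assms by (simp add: smooth_on_def divide_inverse Ck_on_mult Ck_on_inverse)

section \<open>The torus action and charges\<close>

definition weight :: "int ^ 'd ^ 'r \<Rightarrow> real ^ 'r \<Rightarrow> 'd \<Rightarrow> real" where
  "weight Q v j = (\<Sum>k\<in>UNIV. of_int (Q $ k $ j) * v $ k)"

lemma linear_weight: "linear (\<lambda>v. weight Q v j)"
  by (rule linearI) (simp_all add: weight_def algebra_simps sum.distrib sum_distrib_left)

lemma prod_cis: "(\<Prod>k\<in>A. cis (f k)) = cis (\<Sum>k\<in>A. f k)"
  by (induction A rule: infinite_finite_induct) (auto simp: cis_mult)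

lemma torus_act_exp_nth:
  "torus_act Q (torus_exp v) z $ j = cis (weight Q v j) * z $ j"
  by (simp add: torus_act_def torus_exp_def weight_def cis_power_int prod_cis)

lemma linear_torus_act: "linear (torus_act Q l :: complex ^ 'd \<Rightarrow> complex ^ 'd::finite)"
  by (rule linearI) (simp_all add: torus_act_def vec_eq_iff algebra_simps)

lemma has_vector_derivative_vecI:
  fixes f :: "real \<Rightarrow> complex ^ 'd"
  assumes "\<And>j. ((\<lambda>t. f t $ j) has_vector_derivative D $ j) (at t)"
  shows "(f has_vector_derivative D) (at t)"
proof -
  have "((\<lambda>t. f t $ j \<bullet> u) has_derivative (\<lambda>s. (s *\<^sub>R D) $ j \<bullet> u)) (at t)" for j and u :: complex
    using bounded_linear.has_derivative[OF bounded_linear_inner_left assms[unfolded has_vector_derivative_def]]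
    by simp
  then show ?thesis
    unfolding has_vector_derivative_def
    by (subst has_derivative_componentwise_within)
      (auto simp: Basis_vec_def inner_axis simp del: inner_complex_def)
qed

lemma has_vector_derivative_cis:
  "((\<lambda>t. cis (t * w) * c) has_vector_derivative \<i> * of_real w * (cis (s * w) * c)) (at s)"
proof -
  have "exp (t *\<^sub>R (\<i> * of_real w)) = cis (t * w)" for t
    by (simp add: cis_conv_exp scaleR_conv_of_real mult.left_commute)
  moreover have "((\<lambda>t. exp (t *\<^sub>R (\<i> * of_real w)) * c) has_vector_derivative
      exp (s *\<^sub>R (\<i> * of_real w)) * (\<i> * of_real w) * c) (at s)"
    by (intro has_vector_derivative_mult_left exp_scaleR_has_vector_derivative_right)
  ultimately show ?thesis by (simp only: mult_ac)
qed

lemma torus_curve_derivative: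
  "((\<lambda>t. torus_act Q (torus_exp (t *\<^sub>R v)) p) has_vector_derivative
     (\<chi> j. \<i> * of_real (weight Q v j) * torus_act Q (torus_exp (s *\<^sub>R v)) p $ j)) (at s)"
  using has_vector_derivative_cis
  by (intro has_vector_derivative_vecI)
    (simp add: torus_act_exp_nth linear_scale[OF linear_weight])

lemma torus_act_exp_zero: "torus_act Q (torus_exp 0) p = p"
  by (simp add: vec_eq_iff torus_act_exp_nth linear_0[OF linear_weight])

lemma fundamental_field_nth:
  "fundamental_field Q v p $ j = \<i> * of_real (weight Q v j) * p $ j"
  unfolding fundamental_field_def vector_derivative_at[OF torus_curve_derivative]
  by (simp add: torus_act_exp_zero)

text \<open>The torus action is the flow of the fundamental fields and acts by linear maps, which
  are their own differentials. So a form that every group element multiplies by a character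
  has the differential of that character as its charge.\<close>

lemma has_charge_if_equivariant:
  fixes \<Phi> :: "('d::finite, 'k::finite) form" and Q :: "int ^ 'd ^ 'r"
  assumes U: "open U" and form: "differential_form U \<Phi>" and \<theta>: "linear \<theta>"
    and inv: "\<And>v p. p \<in> U \<Longrightarrow> torus_act Q (torus_exp v) p \<in> U"
    and equi: "\<And>v p W. p \<in> U \<Longrightarrow>
      \<Phi> (torus_act Q (torus_exp v) p) (\<chi> i. torus_act Q (torus_exp v) (W $ i))
        = cis (\<theta> v) * \<Phi> p W"
  shows "has_charge U Q \<Phi> (\<lambda>v. \<i> * of_real (\<theta> v))"
  unfolding has_charge_def
proof (intro conjI allI)
  show "linear (\<lambda>v. \<i> * complex_of_real (\<theta> v))"
    by (rule linearI)
      (simp_all add: linear_add[OF \<theta>] linear_scale[OF \<theta>] distrib_left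
        scaleR_conv_of_real[where 'a = complex])
  fix v
  define \<phi> where "\<phi> t = torus_act Q (torus_exp (t *\<^sub>R v))" for t
  have der: "(\<phi> t has_derivative \<phi> t) (at x)" for t x
    unfolding \<phi>_def by (intro linear_imp_has_derivative linear_torus_act)
  have "fundamental_field Q v (\<phi> t x) =
      (\<chi> j. \<i> * of_real (weight Q v j) * torus_act Q (torus_exp (t *\<^sub>R v)) x $ j)" for t x
    by (simp add: vec_eq_iff fundamental_field_nth \<phi>_def)
  then have flow: "((\<lambda>s. \<phi> s x) has_vector_derivative fundamental_field Q v (\<phi> t x)) (at t)" for t x
    using torus_curve_derivative[of Q v x t] by (simp add: \<phi>_def)
  have "local_flow U (fundamental_field Q v) p \<phi>" if "p \<in> U" for p
    unfolding local_flow_def using U that inv flow differentiableI[OF der]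
    by (intro exI[of _ "1 :: real"] exI[of _ U] conjI ballI allI impI)
      (simp_all add: \<phi>_def torus_act_exp_zero)
  moreover have "((\<lambda>t. pullback (\<phi> t) \<Phi> p W) has_vector_derivative \<i> * of_real (\<theta> v) * \<Phi> p W) (at 0)"
    if "p \<in> U" for p W
  proof -
    have "pullback (\<phi> t) \<Phi> p W = cis (t * \<theta> v) * \<Phi> p W" for t
      using equi[OF that, of "t *\<^sub>R v" W] frechet_derivative_at[OF der, of t p]
      by (simp add: pullback_def \<phi>_def linear_scale[OF \<theta>])
    then show ?thesis using has_vector_derivative_cis[of "\<theta> v" "\<Phi> p W" 0] by simp
  qed
  ultimately show "has_Lie_derivative U (fundamental_field Q v) \<Phi>
      (\<lambda>p W. \<i> * of_real (\<theta> v) * \<Phi> p W)"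
    unfolding has_Lie_derivative_def by blast
qed (rule form)

lemma volume_form_eq_det: "wedge dz p W = det W"
  by (simp add: wedge_def dz_def)

lemma differential_form_volume: "differential_form UNIV (wedge dz :: ('d::finite, 'd) form)"
  unfolding differential_form_def volume_form_eq_det
proof (intro conjI ballI allI impI)
  fix W :: "(complex ^ 'd) ^ 'd" and i
  have c: "r *\<^sub>R x = complex_of_real r *s x" for r and x :: "complex ^ 'd"
    by (simp add: vec_eq_iff scaleR_conv_of_real[where 'a = complex])
  show "linear (\<lambda>w. det (\<chi> j. if j = i then w else W $ j))"
    by (rule linearI)
      (simp_all only: det_row_add c det_row_mul scaleR_conv_of_real[where 'a = complex])
next
  fix W :: "(complex ^ 'd) ^ 'd" and i j
  assume "i \<noteq> j" "W $ i = W $ j"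
  then show "det W = 0" by (intro det_identical_rows[of i j]) (simp_all add: row_def)
qed (rule smooth_on_const)

text \<open>A diagonal linear map multiplies the determinant by the product of its entries, so the
  weights of the coordinates add up.\<close>

lemma has_charge_volume:
  fixes Q :: "int ^ 'd ^ 'r"
  shows "has_charge UNIV Q (wedge dz) (\<lambda>v. \<i> * of_real (\<Sum>j\<in>UNIV. weight Q v j))"
proof (rule has_charge_if_equivariant)
  show "linear (\<lambda>v. \<Sum>j\<in>UNIV. weight Q v j)"
    by (intro linear_compose_sum ballI linear_weight)
  fix v p and W :: "(complex ^ 'd) ^ 'd"
  let ?c = "\<lambda>j. cis (weight Q v j)"
  have "det (\<chi> i. torus_act Q (torus_exp v) (W $ i)) = det (transpose (\<chi> j. ?c j *s transpose W $ j))"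
    by (rule arg_cong[of _ _ det]) (simp add: vec_eq_iff transpose_def torus_act_exp_nth)
  also have "\<dots> = cis (\<Sum>j\<in>UNIV. weight Q v j) * det W"
    by (simp only: det_transpose det_rows_mul prod_cis vec_lambda_eta)
  finally show "wedge dz (torus_act Q (torus_exp v) p) (\<chi> i. torus_act Q (torus_exp v) (W $ i))
      = cis (\<Sum>j\<in>UNIV. weight Q v j) * wedge dz p W"
    by (simp add: volume_form_eq_det)
qed (simp_all add: differential_form_volume)

section \<open>The bundle over the Hirzebruch surface\<close>

lemma UNIV_6: "UNIV = {1, 2, 3, 4, 5, 6 :: 6}"
proof -
  have "card {1, 2, 3, 4, 5, 6 :: 6} = CARD(6)" by simp
  then show ?thesis by (metis card_subset_eq finite subset_UNIV)
qed

lemma sum_6: "sum f (UNIV :: 6 set) = f 1 + f 2 + f 3 + f 4 + f 5 + f 6"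
  unfolding UNIV_6 by (simp add: ac_simps)

lemma vector_6:
  "(vector [x1, x2, x3, x4, x5, x6] :: 'a::zero ^ 6) $ 1 = x1"
  "(vector [x1, x2, x3, x4, x5, x6] :: 'a::zero ^ 6) $ 2 = x2"
  "(vector [x1, x2, x3, x4, x5, x6] :: 'a::zero ^ 6) $ 3 = x3"
  "(vector [x1, x2, x3, x4, x5, x6] :: 'a::zero ^ 6) $ 4 = x4"
  "(vector [x1, x2, x3, x4, x5, x6] :: 'a::zero ^ 6) $ 5 = x5"
  "(vector [x1, x2, x3, x4, x5, x6] :: 'a::zero ^ 6) $ 6 = x6"
  unfolding vector_def by simp_all

lemma weight_hirzebruch:
  "weight (hirzebruch_bundle_charges n a) v 1 = v $ 1"
  "weight (hirzebruch_bundle_charges n a) v 2 = v $ 1"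
  "weight (hirzebruch_bundle_charges n a) v 3 = n * v $ 1 + v $ 2"
  "weight (hirzebruch_bundle_charges n a) v 4 = v $ 2"
  "weight (hirzebruch_bundle_charges n a) v 5 = v $ 3"
  "weight (hirzebruch_bundle_charges n a) v 6 = a * v $ 1 - 2 * v $ 2 + v $ 3"
  by (simp_all add: weight_def hirzebruch_bundle_charges_def sum_3 vector_6)

lemma sum_weight_hirzebruch:
  assumes "a = 2 - n"
  shows "(\<Sum>j\<in>UNIV. weight (hirzebruch_bundle_charges n a) v j) = 2 * (2 * v $ 1 + v $ 3)"
  by (simp add: sum_6 weight_hirzebruch assms algebra_simps)

lemma open_hirzebruch_bundle_space: "open hirzebruch_bundle_space"
  unfolding hirzebruch_bundle_space_def prod.inject de_Morgan_conj
  by (intro open_Collect_conj open_Collect_disj open_Collect_neq continuous_intros)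

lemma torus_act_hirzebruch_bundle_space:
  "p \<in> hirzebruch_bundle_space \<Longrightarrow> torus_act Q (torus_exp v) p \<in> hirzebruch_bundle_space"
  by (simp add: hirzebruch_bundle_space_def torus_act_exp_nth)

lemma hirzebruch_base_norm_nonzero:
  assumes "z \<in> hirzebruch_bundle_space"
  shows "z $ 1 * cnj (z $ 1) + z $ 2 * cnj (z $ 2) \<noteq> 0"
proof -
  have "z $ 1 * cnj (z $ 1) + z $ 2 * cnj (z $ 2) = of_real ((cmod (z $ 1))\<^sup>2 + (cmod (z $ 2))\<^sup>2)"
    by (simp only: of_real_add complex_norm_square)
  moreover have "(cmod (z $ 1))\<^sup>2 + (cmod (z $ 2))\<^sup>2 \<noteq> 0"
    using assms by (auto simp: hirzebruch_bundle_space_def sum_power2_eq_zero_iff)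
  ultimately show ?thesis by (simp only: of_real_eq_0_iff not_False_eq_True)
qed

text \<open>Writing \<open>|z|\<^sup>2\<close> as \<open>z * cnj z\<close> makes the coefficients rational in the coordinates and their
  conjugates, which both smoothness and the action of the phases can be read off from.\<close>

lemma hirzebruch_bundle_form_eq:
  "hirzebruch_bundle_form n z W =
     z $ 5 * (- (z $ 2) * W $ 1 $ 1 + z $ 1 * W $ 1 $ 2)
     + z $ 6 * (- (z $ 4) * W $ 1 $ 3 + z $ 3 * W $ 1 $ 4
         + of_int n * z $ 3 * z $ 4 / (z $ 1 * cnj (z $ 1) + z $ 2 * cnj (z $ 2))
           * (cnj (z $ 1) * W $ 1 $ 1 + cnj (z $ 2) * W $ 1 $ 2))"
  by (simp only: hirzebruch_bundle_form_def dz_def of_real_add complex_norm_square)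

lemma differential_form_hirzebruch:
  "differential_form hirzebruch_bundle_space (hirzebruch_bundle_form n)"
  unfolding differential_form_def
proof (intro conjI ballI allI impI)
  fix p :: "complex ^ 6" and W :: "(complex ^ 6) ^ 1" and i :: 1
  have i: "i = 1" by (rule num1_eq1)
  show "linear (\<lambda>w. hirzebruch_bundle_form n p (\<chi> j. if j = i then w else W $ j))"
    by (rule linearI)
      (simp_all add: i hirzebruch_bundle_form_eq algebra_simps add_divide_distrib
        scaleR_conv_of_real[where 'a = complex])
next
  fix W :: "(complex ^ 6) ^ 1"
  have nth: "smooth_on hirzebruch_bundle_space (\<lambda>z::complex ^ 6. z $ j)"
    and cnj: "smooth_on hirzebruch_bundle_space (\<lambda>z::complex ^ 6. cnj (z $ j))" for j
    by (auto intro!: smooth_on_bounded_linear open_hirzebruch_bundle_space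
        bounded_linear_compose[OF bounded_linear_cnj])
  show "smooth_on hirzebruch_bundle_space (\<lambda>p. hirzebruch_bundle_form n p W)"
    unfolding hirzebruch_bundle_form_eq
    by (intro smooth_on_add smooth_on_mult smooth_on_divide smooth_on_uminus smooth_on_const
        open_hirzebruch_bundle_space nth cnj hirzebruch_base_norm_nonzero)
next
  fix W :: "(complex ^ 6) ^ 1" and i j :: 1 and p
  assume "i \<noteq> j"
  then show "hirzebruch_bundle_form n p W = 0" by (metis num1_eq1)
qed

text \<open>The coefficients of \<open>dz\<^sub>3\<close> and \<open>dz\<^sub>4\<close> vanish only where \<open>z\<^sub>6 = 0\<close>; there \<open>z\<^sub>5 \<noteq> 0\<close>, and those
  of \<open>dz\<^sub>1\<close> and \<open>dz\<^sub>2\<close> reduce to \<open>- z\<^sub>5 z\<^sub>2\<close> and \<open>z\<^sub>5 z\<^sub>1\<close>.\<close>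

lemma nowhere_vanishing_hirzebruch:
  "nowhere_vanishing hirzebruch_bundle_space (hirzebruch_bundle_form n)"
  unfolding nowhere_vanishing_def
proof (rule ballI, rule ccontr)
  fix p assume p: "p \<in> hirzebruch_bundle_space"
  assume "\<nexists>W. hirzebruch_bundle_form n p W \<noteq> 0"
  then have 0: "hirzebruch_bundle_form n p (vec (axis j 1)) = 0" for j by blast
  have "p $ 6 * p $ 4 = 0" "p $ 6 * p $ 3 = 0"
    using 0[of 3] 0[of 4] by (simp_all add: hirzebruch_bundle_form_eq axis_def)
  then have p6: "p $ 6 = 0" using p by (auto simp: hirzebruch_bundle_space_def)
  have "p $ 5 * p $ 2 = 0" "p $ 5 * p $ 1 = 0"
    using 0[of 1] 0[of 2] by (simp_all add: hirzebruch_bundle_form_eq axis_def p6)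
  with p p6 show False by (auto simp: hirzebruch_bundle_space_def)
qed

text \<open>The first summand is the contraction of \<open>dz\<^sub>1 \<and> dz\<^sub>2\<close> with the radial field, and the
  fundamental fields are complex multiples of that field in the \<open>z\<^sub>1, z\<^sub>2\<close> directions. The same expression in \<open>z\<^sub>3, z\<^sub>4\<close> sees the difference \<open>n v\<^sub>1\<close> of their weights, and the
  correction term, whose value on the fundamental field is proportional to \<open>v\<^sub>1\<close>, cancels
  exactly this.\<close>

lemma horizontal_hirzebruch:
  "horizontal hirzebruch_bundle_space (hirzebruch_bundle_charges n a) (hirzebruch_bundle_form n)"
  unfolding horizontal_def
proof (intro allI ballI)
  fix v :: "real ^ 3" and p :: "complex ^ 6"
  assume "p \<in> hirzebruch_bundle_space"
  then have D: "p $ 1 * cnj (p $ 1) + p $ 2 * cnj (p $ 2) \<noteq> 0" (is "?D \<noteq> 0")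
    by (rule hirzebruch_base_norm_nonzero)
  have "cnj (p $ 1) * (\<i> * v $ 1 * p $ 1) + cnj (p $ 2) * (\<i> * v $ 1 * p $ 2) = \<i> * v $ 1 * ?D"
    by (simp add: algebra_simps)
  with D show "hirzebruch_bundle_form n p
      (vec (fundamental_field (hirzebruch_bundle_charges n a) v p)) = 0"
    by (simp add: hirzebruch_bundle_form_eq fundamental_field_nth weight_hirzebruch)
      (simp add: algebra_simps)
qed

text \<open>The monomials \<open>z\<^sub>5 z\<^sub>1 z\<^sub>2\<close> and \<open>z\<^sub>6 z\<^sub>3 z\<^sub>4\<close> have the weights \<open>2 v\<^sub>1 + v\<^sub>3\<close> and
  \<open>(n + a) v\<^sub>1 + v\<^sub>3\<close>; the condition on \<open>a\<close> makes them equal.\<close>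

lemma has_charge_hirzebruch:
  assumes a: "a = 2 - n"
  shows "has_charge hirzebruch_bundle_space (hirzebruch_bundle_charges n a)
    (hirzebruch_bundle_form n) (\<lambda>v. \<i> * of_real (2 * v $ 1 + v $ 3))"
proof (rule has_charge_if_equivariant)
  show "linear (\<lambda>v::real ^ 3. 2 * v $ 1 + v $ 3)"
    by (rule linearI) (simp_all add: algebra_simps)
next
  fix v p and W :: "(complex ^ 6) ^ 1"
  let ?Q = "hirzebruch_bundle_charges n a"
  define s where "s j = cis (weight ?Q v j)" for j
  define c where "c = cis (2 * v $ 1 + v $ 3)"
  have s2: "s 2 = s 1" by (simp add: s_def weight_hirzebruch)
  have unit: "s 1 * cnj (s 1) = 1" by (simp add: s_def cis_cnj cis_mult)
  have base: "s 5 * s 1 * s 1 = c"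
    and fibre: "s 6 * s 3 * s 4 = c"
    by (simp_all add: s_def c_def cis_mult weight_hirzebruch a algebra_simps)
  have act: "torus_act ?Q (torus_exp v) z $ j = s j * z $ j" for z j
    by (simp add: torus_act_exp_nth s_def)
  have invariant: "s 1 * x * (cnj (s 1) * y) = x * y" "cnj (s 1) * x * (s 1 * y) = x * y" for x y
    using unit by (metis mult.assoc mult.commute mult.left_neutral)+
  have "hirzebruch_bundle_form n (torus_act ?Q (torus_exp v) p)
      (\<chi> i. torus_act ?Q (torus_exp v) (W $ i)) =
     (s 5 * s 1 * s 1) * (p $ 5 * (- (p $ 2) * W $ 1 $ 1 + p $ 1 * W $ 1 $ 2))
     + (s 6 * s 3 * s 4) * (p $ 6 * (- (p $ 4) * W $ 1 $ 3 + p $ 3 * W $ 1 $ 4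
         + of_int n * p $ 3 * p $ 4 / (p $ 1 * cnj (p $ 1) + p $ 2 * cnj (p $ 2))
           * (cnj (p $ 1) * W $ 1 $ 1 + cnj (p $ 2) * W $ 1 $ 2)))"
    unfolding hirzebruch_bundle_form_eq
    by (simp only: act s2 invariant complex_cnj_mult vec_lambda_beta)
      (simp only: divide_inverse distrib_left distrib_right mult_minus_left mult_minus_right mult_ac)
  also have "\<dots> = c * hirzebruch_bundle_form n p W"
    unfolding base fibre hirzebruch_bundle_form_eq by (simp only: distrib_left)
  finally show "hirzebruch_bundle_form n (torus_act ?Q (torus_exp v) p)
      (\<chi> i. torus_act ?Q (torus_exp v) (W $ i)) =
      cis (2 * v $ 1 + v $ 3) * hirzebruch_bundle_form n p W"
    by (simp add: c_def)
qed (simp_all add: open_hirzebruch_bundle_space differential_form_hirzebruch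
    torus_act_hirzebruch_bundle_space)

lemma type_1_0_hirzebruch: "type_1_0 hirzebruch_bundle_space (hirzebruch_bundle_form n)"
  by (simp add: type_1_0_def hirzebruch_bundle_form_eq algebra_simps add_divide_distrib)

theorem proposition7:
  fixes n a :: int
  assumes "a = 2 - n"
  shows "\<exists>q. has_charge UNIV (hirzebruch_bundle_charges n a) \<Omega>\<^sub>0 q \<and>
    twist_form hirzebruch_bundle_space (hirzebruch_bundle_charges n a) (hirzebruch_bundle_form n) \<and>
    has_charge hirzebruch_bundle_space (hirzebruch_bundle_charges n a) (hirzebruch_bundle_form n)
      (\<lambda>v. q v / 2)"
proof (intro exI conjI)
  let ?q = "\<lambda>v::real ^ 3. \<i> * complex_of_real (2 * (2 * v $ 1 + v $ 3))"
  show "has_charge UNIV (hirzebruch_bundle_charges n a) \<Omega>\<^sub>0 ?q"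
    using has_charge_volume[of "hirzebruch_bundle_charges n a"]
    by (simp only: sum_weight_hirzebruch[OF assms] \<Omega>\<^sub>0_def)
  have half: "?q v / 2 = \<i> * of_real (2 * v $ 1 + v $ 3)" for v by simp
  show "has_charge hirzebruch_bundle_space (hirzebruch_bundle_charges n a)
      (hirzebruch_bundle_form n) (\<lambda>v. ?q v / 2)"
    unfolding half by (rule has_charge_hirzebruch[OF assms])
  show "twist_form hirzebruch_bundle_space (hirzebruch_bundle_charges n a)
      (hirzebruch_bundle_form n)"
    unfolding twist_form_def
    using has_charge_hirzebruch[OF assms] differential_form_hirzebruch
      nowhere_vanishing_hirzebruch type_1_0_hirzebruch horizontal_hirzebruch by blast
qed

end
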